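(* Let $G$ be a strongly topological gyrogroup and let $H$ be a locally compact metrizable strong subgyrogroup of $G$. If the quotient space $G/H$ is strictly Fréchet-Urysohn, then $G$ is also strictly Fréchet-Urysohn.
   Context: All topological spaces are assumed Hausdorff. A gyrogroup is a nonempty set $G$ with a binary operation $\oplus$ such that: (G1) there is a unique $0\in G$ with $0\oplus a=a=a\oplus 0$ for all $a$; (G2) each $x\in G$ has a unique inverse $\ominus x$ with $\ominus x\oplus x=0=x\oplus(\ominus x)$; (G3) for all $x,y\in G$ there is an automorphism $\mathrm{gyr}[x,y]$ of $(G,\oplus)$ with $x\oplus(y\oplus z)=(x\oplus y)\oplus\mathrm{gyr}[x,y](z)$ for all $z\in G$; (G4) $\mathrm{gyr}[x\oplus y,y]=\mathrm{gyr}[x,y]$ for all $x,y\in G$. A topological gyrogroup is a gyrogroup with a topology making $\oplus:G\times G\to G$ jointly continuous and $x\mapsto\ominus x$ continuous. It is a strongly topological gyrogroup if there is a neighborhood base $\mathscr U$ of $0$ with $\mathrm{gyr}[x,y](U)=U$ for all $U\in\mathscr U$ and $x,y\in G$. A subgyrogroup is a nonempty subset $H\subseteq G$ that is a gyrogroup under the inherited operation and such that $\mathrm{gyr}[a,b]$ restricts to an automorphism of $H$ for all $a,b\in H$. It is a strong subgyrogroup if $\mathrm{gyr}[x,y](H)=H$ for all $x,y\in G$. For such $H$ the left cosets $a\oplus H$ ($a\in G$) partition $G$; $G/H=\{a\oplus H:a\in G\}$ carries the quotient topology induced by $\pi:G\to G/H$, $\pi(a)=a\oplus H$. Subgyrogroups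 carry the subspace topology. A space $X$ is strictly Fréchet-Urysohn if for every $x\in X$ and every sequence $\{A_n\}_{n\in\mathbb N}$ of subsets of $X$ with $x\in\bigcap_{n\in\mathbb N}\overline{A_n}$ there exist $x_n\in A_n$ for each $n\in\mathbb N$ such that $\{x_n\}_n$ converges to $x$. *)

theory Defs
  imports "HOL-Analysis.Analysis"
begin

section \<open>Gyrogroups\<close>

definition gyro_zero :: "'a set \<Rightarrow> ('a \<Rightarrow> 'a \<Rightarrow> 'a) \<Rightarrow> 'a" where
  "gyro_zero G add = (THE e. e \<in> G \<and> (\<forall>a\<in>G. add e a = a \<and> add a e = a))"

definition gyro_minus :: "'a set \<Rightarrow> ('a \<Rightarrow> 'a \<Rightarrow> 'a) \<Rightarrow> 'a \<Rightarrow> 'a" where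
  "gyro_minus G add x =
     (THE y. y \<in> G \<and> add y x = gyro_zero G add \<and> add x y = gyro_zero G add)"

definition magma_auto :: "'a set \<Rightarrow> ('a \<Rightarrow> 'a \<Rightarrow> 'a) \<Rightarrow> ('a \<Rightarrow> 'a) \<Rightarrow> bool" where
  "magma_auto G add f \<longleftrightarrow>
     bij_betw f G G \<and> (\<forall>x\<in>G. \<forall>y\<in>G. f (add x y) = add (f x) (f y))"

text \<open>
  The gyrations are carried as a parameter \<open>gyr\<close>; only the values \<open>gyr x y z\<close> with
  \<open>x, y, z \<in> G\<close> are constrained, so equality of gyrations means equality on \<open>G\<close>.
\<close>

locale gyrogroup =
  fixes G :: "'a set" and add :: "'a \<Rightarrow> 'a \<Rightarrow> 'a" and gyr :: "'a \<Rightarrow> 'a \<Rightarrow> 'a \<Rightarrow> 'a"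
  assumes nonempty: "G \<noteq> {}"
    and closed: "\<lbrakk>x \<in> G; y \<in> G\<rbrakk> \<Longrightarrow> add x y \<in> G"
    and ex1_zero: "\<exists>!e. e \<in> G \<and> (\<forall>a\<in>G. add e a = a \<and> add a e = a)"
    and ex1_minus: "x \<in> G \<Longrightarrow>
          \<exists>!y. y \<in> G \<and> add y x = gyro_zero G add \<and> add x y = gyro_zero G add"
    and gyr_auto: "\<lbrakk>x \<in> G; y \<in> G\<rbrakk> \<Longrightarrow> magma_auto G add (gyr x y)"
    and gyr_assoc: "\<lbrakk>x \<in> G; y \<in> G; z \<in> G\<rbrakk> \<Longrightarrow>
          add x (add y z) = add (add x y) (gyr x y z)"
    and gyr_loop: "\<lbrakk>x \<in> G; y \<in> G; z \<in> G\<rbrakk> \<Longrightarrow> gyr (add x y) y z = gyr x y z"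

definition subgyrogroup ::
  "'a set \<Rightarrow> ('a \<Rightarrow> 'a \<Rightarrow> 'a) \<Rightarrow> ('a \<Rightarrow> 'a \<Rightarrow> 'a \<Rightarrow> 'a) \<Rightarrow> 'a set \<Rightarrow> bool" where
  "subgyrogroup G add gyr H \<longleftrightarrow>
     H \<noteq> {} \<and> H \<subseteq> G \<and> (\<exists>gyr'. gyrogroup H add gyr') \<and>
     (\<forall>a\<in>H. \<forall>b\<in>H. magma_auto H add (gyr a b))"

definition strong_subgyrogroup ::
  "'a set \<Rightarrow> ('a \<Rightarrow> 'a \<Rightarrow> 'a) \<Rightarrow> ('a \<Rightarrow> 'a \<Rightarrow> 'a \<Rightarrow> 'a) \<Rightarrow> 'a set \<Rightarrow> bool" where
  "strong_subgyrogroup G add gyr H \<longleftrightarrow>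
     subgyrogroup G add gyr H \<and> (\<forall>x\<in>G. \<forall>y\<in>G. gyr x y ` H = H)"


section \<open>Topological gyrogroups\<close>

locale topological_gyrogroup = gyrogroup G add gyr
  for G :: "'a set" and add gyr +
  fixes T :: "'a topology"
  assumes topspace_eq: "topspace T = G"
    and Hausdorff: "Hausdorff_space T"
    and continuous_add: "continuous_map (prod_topology T T) T (\<lambda>(x, y). add x y)"
    and continuous_minus: "continuous_map T T (gyro_minus G add)"

text \<open>Neighbourhoods, and hence members of a neighbourhood base, need not be open.\<close>

definition nhd_base_at :: "'a topology \<Rightarrow> 'a \<Rightarrow> 'a set set \<Rightarrow> bool" where
  "nhd_base_at X x \<U> \<longleftrightarrow>
     (\<forall>U\<in>\<U>. U \<subseteq> topspace X \<and> x \<in> X interior_of U) \<and>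
     (\<forall>W. openin X W \<and> x \<in> W \<longrightarrow> (\<exists>U\<in>\<U>. U \<subseteq> W))"

locale strongly_topological_gyrogroup = topological_gyrogroup +
  assumes gyr_invariant_base:
    "\<exists>\<U>. nhd_base_at T (gyro_zero G add) \<U> \<and> (\<forall>U\<in>\<U>. \<forall>x\<in>G. \<forall>y\<in>G. gyr x y ` U = U)"


section \<open>Quotient spaces\<close>

definition quotient_topology :: "'a topology \<Rightarrow> ('a \<Rightarrow> 'b) \<Rightarrow> 'b topology" where
  "quotient_topology X p =
     topology (\<lambda>V. V \<subseteq> p ` topspace X \<and> openin X {x \<in> topspace X. p x \<in> V})"

lemma openin_quotient_topology:
  "openin (quotient_topology X p) V \<longleftrightarrow>
     V \<subseteq> p ` topspace X \<and> openin X {x \<in> topspace X. p x \<in> V}"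
proof -
  have "istopology (\<lambda>V. V \<subseteq> p ` topspace X \<and> openin X {x \<in> topspace X. p x \<in> V})"
    unfolding istopology_def
  proof (intro conjI allI impI)
    fix S T
    assume "S \<subseteq> p ` topspace X \<and> openin X {x \<in> topspace X. p x \<in> S}"
      and "T \<subseteq> p ` topspace X \<and> openin X {x \<in> topspace X. p x \<in> T}"
    moreover have "{x \<in> topspace X. p x \<in> S \<inter> T} =
        {x \<in> topspace X. p x \<in> S} \<inter> {x \<in> topspace X. p x \<in> T}" by blast
    ultimately show "S \<inter> T \<subseteq> p ` topspace X" "openin X {x \<in> topspace X. p x \<in> S \<inter> T}"
      by auto
  next
    fix \<K>
    assume *: "\<forall>K\<in>\<K>. K \<subseteq> p ` topspace X \<and> openin X {x \<in> topspace X. p x \<in> K}"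
    then show "\<Union>\<K> \<subseteq> p ` topspace X" by blast
    have "{x \<in> topspace X. p x \<in> \<Union>\<K>} = (\<Union>K\<in>\<K>. {x \<in> topspace X. p x \<in> K})" by blast
    with * show "openin X {x \<in> topspace X. p x \<in> \<Union>\<K>}" by auto
  qed
  then show ?thesis
    by (simp add: quotient_topology_def)
qed

lemma topspace_quotient_topology [simp]:
  "topspace (quotient_topology X p) = p ` topspace X"
proof -
  have "{x \<in> topspace X. p x \<in> p ` topspace X} = topspace X" by blast
  then have "openin (quotient_topology X p) (p ` topspace X)"
    by (simp add: openin_quotient_topology)
  then show ?thesis
    by (meson openin_quotient_topology openin_subset openin_topspace subset_antisym)
qed

lemma quotient_map_quotient_topology: "quotient_map X (quotient_topology X p) p"
  by (simp add: quotient_map_def openin_quotient_topology)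

definition left_coset :: "('a \<Rightarrow> 'a \<Rightarrow> 'a) \<Rightarrow> 'a set \<Rightarrow> 'a \<Rightarrow> 'a set" where
  "left_coset add H a = add a ` H"

definition coset_space :: "'a topology \<Rightarrow> ('a \<Rightarrow> 'a \<Rightarrow> 'a) \<Rightarrow> 'a set \<Rightarrow> 'a set topology" where
  "coset_space T add H = quotient_topology T (left_coset add H)"


section \<open>Strictly Frechet-Urysohn spaces\<close>

definition strictly_frechet_urysohn :: "'a topology \<Rightarrow> bool" where
  "strictly_frechet_urysohn X \<longleftrightarrow>
     (\<forall>x \<in> topspace X. \<forall>A :: nat \<Rightarrow> 'a set.
        (\<forall>n. A n \<subseteq> topspace X) \<and> x \<in> (\<Inter>n. X closure_of A n) \<longrightarrow>
        (\<exists>s. (\<forall>n. s n \<in> A n) \<and> limitin X s x sequentially))"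

end

(* After a left translation, let 0 be in the closure of every A n.  Choose open neighbourhoods V n
   of 0 with V (n + 1) + V (n + 1) inside V n whose traces on H form a base at 0, and points b n
   of A n and V n whose cosets converge to H.  Then b n converges to 0: since the projection onto
   G/H is open, eventually b n = a + h with h in H and a as close to 0 as we please, and
   h = -a + b n lies in H and V m, so h is close to 0 as well. *)

theory Submission
  imports Defs
begin

section \<open>Cancellation laws and cosets in a gyrogroup\<close>

context gyrogroup
begin

abbreviation "gzero \<equiv> gyro_zero G add"
abbreviation "gneg \<equiv> gyro_minus G add"

lemma zero_props: "gzero \<in> G \<and> (\<forall>a\<in>G. add gzero a = a \<and> add a gzero = a)"
  unfolding gyro_zero_def by (rule theI') (rule ex1_zero)

lemma zero_closed: "gzero \<in> G"
  and add_zero_left: "a \<in> G \<Longrightarrow> add gzero a = a"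
  and add_zero_right: "a \<in> G \<Longrightarrow> add a gzero = a"
  using zero_props by auto

lemma minus_props:
  assumes "a \<in> G"
  shows "gneg a \<in> G \<and> add (gneg a) a = gzero \<and> add a (gneg a) = gzero"
  unfolding gyro_minus_def by (rule theI') (rule ex1_minus[OF assms])

lemma minus_closed: "a \<in> G \<Longrightarrow> gneg a \<in> G"
  and minus_left: "a \<in> G \<Longrightarrow> add (gneg a) a = gzero"
  using minus_props by auto

lemma gyr_closed:
  assumes "x \<in> G" "y \<in> G" "z \<in> G"
  shows "gyr x y z \<in> G"
  using gyr_auto[OF assms(1,2)] assms(3) unfolding magma_auto_def by (auto dest: bij_betwE)

text \<open>Adding \<open>gneg a\<close> on the left turns \<open>add a z\<close> into the gyration
  of \<open>z\<close> by \<open>gneg a\<close> and \<open>a\<close>, and gyrations are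
  injective.\<close>

lemma add_left_imp_eq:
  assumes "a \<in> G" "x \<in> G" "y \<in> G" and eq: "add a x = add a y"
  shows "x = y"
proof -
  let ?g = "gyr (gneg a) a"
  have *: "add (gneg a) (add a z) = ?g z" if "z \<in> G" for z
    using that assms(1) by (simp add: gyr_assoc minus_closed minus_left add_zero_left gyr_closed)
  have "?g x = ?g y"
    using *[of x] *[of y] eq assms by simp
  moreover have "inj_on ?g G"
    using gyr_auto[of "gneg a" a] assms(1) minus_closed
    unfolding magma_auto_def bij_betw_def by blast
  ultimately show ?thesis
    using assms by (auto dest: inj_onD)
qed

text \<open>With zero as first summand, \<open>gyr_assoc\<close> has the same left summand
  \<open>a\<close> on both sides, which cancels.\<close>

lemma gyr_zero_left:
  assumes "a \<in> G" "z \<in> G"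
  shows "gyr gzero a z = z"
proof -
  have "add a z = add a (gyr gzero a z)"
    using gyr_assoc[of gzero a z] assms by (simp add: zero_closed add_zero_left closed)
  then show ?thesis
    using add_left_imp_eq[of a "gyr gzero a z" z] assms gyr_closed zero_closed by simp
qed

text \<open>By the loop property, \<open>gyr (gneg a) a\<close> agrees with
  \<open>gyr gzero a\<close>, the identity, so reassociating leaves no gyration behind.\<close>

lemma minus_add_cancel:
  assumes "a \<in> G" "b \<in> G"
  shows "add (gneg a) (add a b) = b"
proof -
  have "gyr (gneg a) a b = gyr (add (gneg a) a) a b"
    using gyr_loop[of "gneg a" a b] assms minus_closed by simp
  then show ?thesis
    using assms by (simp add: gyr_assoc minus_closed minus_left add_zero_left gyr_zero_left)
qed

text \<open>Adding \<open>gneg a\<close> on the left reduces both sides to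
  \<open>add (gneg a) b\<close>; the value of \<open>gneg (gneg a)\<close> never enters.\<close>

lemma add_minus_cancel:
  assumes "a \<in> G" "b \<in> G"
  shows "add a (add (gneg a) b) = b"
  by (rule add_left_imp_eq[of "gneg a"])
    (simp_all add: assms closed minus_closed minus_add_cancel)

lemma minus_zero: "gneg gzero = gzero"
  using minus_left[OF zero_closed] add_zero_right[OF minus_closed[OF zero_closed]] by simp

text \<open>Stated for the whole carrier so that it can be instantiated with a subgyrogroup regarded
  as a gyrogroup of its own.\<close>

lemma left_coset_self:
  assumes "h \<in> G"
  shows "left_coset add G h = G"
proof
  show "left_coset add G h \<subseteq> G"
    using assms closed by (auto simp: left_coset_def)
  show "G \<subseteq> left_coset add G h"
  proof
    fix k assume "k \<in> G"
    then show "k \<in> left_coset add G h"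
      unfolding left_coset_def
      by (intro image_eqI[where x = "add (gneg h) k"])
        (simp_all add: assms add_minus_cancel closed minus_closed)
  qed
qed

lemma strong_subgyrogroupD:
  assumes "strong_subgyrogroup G add gyr H"
  shows "H \<subseteq> G"
    and "\<And>x y. x \<in> G \<Longrightarrow> y \<in> G \<Longrightarrow> gyr x y ` H = H"
    and "\<And>h. h \<in> H \<Longrightarrow> left_coset add H h = H"
    and "gzero \<in> H"
proof -
  from assms obtain gyr' where H: "gyrogroup H add gyr'" and sub: "H \<subseteq> G"
    unfolding strong_subgyrogroup_def subgyrogroup_def by blast
  \<comment> \<open>\<open>gyr'\<close> may differ from \<open>gyr\<close>; the facts taken from
    this interpretation mention the operation alone.\<close>
  interpret H: gyrogroup H add gyr' by (rule H)
  show "H \<subseteq> G" by (rule sub)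
  show "gyr x y ` H = H" if "x \<in> G" "y \<in> G" for x y
    using assms that unfolding strong_subgyrogroup_def by blast
  show "left_coset add H h = H" if "h \<in> H" for h
    using that by (rule H.left_coset_self)
  have e: "gyro_zero H add \<in> G"
    using H.zero_closed sub by auto
  \<comment> \<open>The zero \<open>e\<close> of \<open>H\<close> satisfies
    \<open>add e e = e = add e gzero\<close>, and left cancellation in \<open>G\<close>
    applies.\<close>
  have "gyro_zero H add = gzero"
    by (rule add_left_imp_eq[OF e e zero_closed])
      (simp add: H.add_zero_left H.zero_closed add_zero_right e)
  then show "gzero \<in> H"
    using H.zero_closed by simp
qed

text \<open>Since gyrations map \<open>H\<close> onto itself, (x + h) + H = (x + h) + gyr[x,h](H) =
  x + (h + H) = x + H.\<close>

lemma left_coset_add: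
  assumes H: "strong_subgyrogroup G add gyr H" and "x \<in> G" "h \<in> H"
  shows "left_coset add H (add x h) = left_coset add H x"
proof -
  note H' = strong_subgyrogroupD[OF H]
  have h: "h \<in> G" using H'(1) assms(3) by auto
  have "left_coset add H (add x h) = add (add x h) ` gyr x h ` H"
    using H'(2)[OF assms(2) h] by (simp add: left_coset_def)
  also have "\<dots> = add x ` add h ` H"
    unfolding image_image
    by (rule image_cong[OF refl], rule gyr_assoc[symmetric]) (use assms(2) h H'(1) in auto)
  also have "\<dots> = left_coset add H x"
    using H'(3)[OF assms(3)] by (simp add: left_coset_def)
  finally show ?thesis .
qed

end

section \<open>Translations, neighbourhoods of zero and the coset projection\<close>

context topological_gyrogroup
begin

lemma continuous_map_add_left:
  assumes "a \<in> G"
  shows "continuous_map T T (add a)"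
proof -
  have "continuous_map T (prod_topology T T) (\<lambda>x. (a, x))"
    using assms by (intro continuous_map_pairedI) (simp_all add: topspace_eq)
  from continuous_map_compose[OF this continuous_add] show ?thesis
    by (simp add: o_def)
qed

lemma continuous_map_add_right:
  assumes "a \<in> G"
  shows "continuous_map T T (\<lambda>x. add x a)"
proof -
  have "continuous_map T (prod_topology T T) (\<lambda>x. (x, a))"
    using assms by (intro continuous_map_pairedI) (simp_all add: topspace_eq)
  from continuous_map_compose[OF this continuous_add] show ?thesis
    by (simp add: o_def)
qed

text \<open>Continuity of addition at (0, 0) gives an open box mapped into \<open>U\<close>; the
  intersection of its two sides serves as \<open>V\<close>.\<close>

lemma nhd_zero_add:
  assumes "openin T U" "gzero \<in> U"
  obtains V where "openin T V" "gzero \<in> V" "\<And>x y. x \<in> V \<Longrightarrow> y \<in> V \<Longrightarrow> add x y \<in> U"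
proof -
  define D where "D = {z \<in> topspace (prod_topology T T). (\<lambda>(x, y). add x y) z \<in> U}"
  have "openin (prod_topology T T) D"
    unfolding D_def using openin_continuous_map_preimage[OF continuous_add assms(1)] .
  moreover have "(gzero, gzero) \<in> D"
    using assms zero_closed by (simp add: D_def topspace_eq add_zero_left)
  ultimately obtain A B where AB: "openin T A" "openin T B" "gzero \<in> A" "gzero \<in> B" "A \<times> B \<subseteq> D"
    unfolding openin_prod_topology_alt by metis
  show ?thesis
  proof
    show "openin T (A \<inter> B)" "gzero \<in> A \<inter> B"
      using AB by auto
    show "add x y \<in> U" if "x \<in> A \<inter> B" "y \<in> A \<inter> B" for x y
      using AB(5) that by (auto simp: D_def)
  qed
qed

text \<open>Dependent choice: each new set is a neighbourhood from \<open>nhd_zero_add\<close> for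
  the previous one, cut down by the next \<open>W\<close>.\<close>

lemma nhd_zero_sequence:
  assumes "\<And>n::nat. openin T (W n) \<and> gzero \<in> W n"
  shows "\<exists>V. (\<forall>n. openin T (V n) \<and> gzero \<in> V n \<and> V n \<subseteq> W n) \<and>
    (\<forall>n. \<forall>x\<in>V (Suc n). \<forall>y\<in>V (Suc n). add x y \<in> V n) \<and> decseq V"
proof -
  have "\<exists>V. \<forall>n. (openin T (V n) \<and> gzero \<in> V n \<and> V n \<subseteq> W n) \<and>
        (\<forall>x\<in>V (Suc n). \<forall>y\<in>V (Suc n). add x y \<in> V n)"
  proof (rule dependent_nat_choice)
    show "\<exists>U. openin T U \<and> gzero \<in> U \<and> U \<subseteq> W 0"
      using assms[of 0] by blast
    fix U and n :: nat
    assume "openin T U \<and> gzero \<in> U \<and> U \<subseteq> W n"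
    then obtain V where V: "openin T V" "gzero \<in> V"
      "\<And>x y. x \<in> V \<Longrightarrow> y \<in> V \<Longrightarrow> add x y \<in> U"
      using nhd_zero_add by metis
    show "\<exists>V. (openin T V \<and> gzero \<in> V \<and> V \<subseteq> W (Suc n)) \<and> (\<forall>x\<in>V. \<forall>y\<in>V. add x y \<in> U)"
      using V assms[of "Suc n"] by (intro exI[of _ "V \<inter> W (Suc n)"]) auto
  qed
  then obtain V where V: "\<forall>n. (openin T (V n) \<and> gzero \<in> V n \<and> V n \<subseteq> W n) \<and>
        (\<forall>x\<in>V (Suc n). \<forall>y\<in>V (Suc n). add x y \<in> V n)" ..
  \<comment> \<open>Monotonicity comes from the sum condition by adding zero, itself a point of
    \<open>V (Suc n)\<close>.\<close>
  have "V (Suc n) \<subseteq> V n" for n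
  proof
    fix x assume x: "x \<in> V (Suc n)"
    then have "x \<in> G"
      using V openin_subset topspace_eq by blast
    moreover have "add x gzero \<in> V n"
      using V x by blast
    ultimately show "x \<in> V n"
      by (simp add: add_zero_right)
  qed
  then have "decseq V"
    by (rule decseq_SucI)
  with V show ?thesis
    by (intro exI[of _ V]) simp
qed

text \<open>The saturation of an open set is a union of preimages under right translations by
  elements of \<open>H\<close>, hence open.\<close>

lemma open_map_left_coset:
  assumes H: "strong_subgyrogroup G add gyr H"
  shows "open_map T (coset_space T add H) (left_coset add H)"
  unfolding open_map_def coset_space_def openin_quotient_topology
proof (intro allI impI conjI)
  note H' = strong_subgyrogroupD[OF H]
  fix U assume U: "openin T U"
  then have UG: "U \<subseteq> G"
    using openin_subset topspace_eq by blast
  then show "left_coset add H ` U \<subseteq> left_coset add H ` topspace T"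
    using topspace_eq by auto
  have "{x \<in> topspace T. left_coset add H x \<in> left_coset add H ` U} =
    (\<Union>h\<in>H. {x \<in> topspace T. add x h \<in> U})" (is "?L = ?R")
  proof
    show "?L \<subseteq> ?R"
    proof
      fix x assume "x \<in> ?L"
      then obtain p where p: "x \<in> topspace T" "p \<in> U" "left_coset add H x = left_coset add H p"
        by auto
      \<comment> \<open>As \<open>H\<close> contains zero, \<open>p\<close> lies in its own coset,
        which is also that of \<open>x\<close>.\<close>
      have "p \<in> left_coset add H p"
        unfolding left_coset_def using H'(4) p(2) UG add_zero_right by force
      then obtain h where "h \<in> H" "p = add x h"
        unfolding p(3)[symmetric] by (auto simp: left_coset_def)
      with p show "x \<in> ?R"
        by auto
    qed
    show "?R \<subseteq> ?L"
    proof
      fix x assume "x \<in> ?R"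
      then obtain h where h: "h \<in> H" "x \<in> G" "add x h \<in> U"
        using topspace_eq by auto
      then show "x \<in> ?L"
        using left_coset_add[OF H h(2,1)] topspace_eq by (metis (mono_tags) image_eqI mem_Collect_eq)
    qed
  qed
  moreover have "openin T ?R"
    using H'(1) continuous_map_add_right openin_continuous_map_preimage[OF _ U] by blast
  ultimately show "openin T ?L"
    by simp
qed

section \<open>Lifting convergence from the coset space\<close>

text \<open>Coset convergence controls \<open>b n\<close> up to a summand from \<open>H\<close>; the
  sets \<open>V n\<close> bound that summand, because their traces shrink to zero inside
  \<open>H\<close>.\<close>

lemma limitin_zero_of_coset_limit:
  assumes H: "strong_subgyrogroup G add gyr H"
    and base: "\<And>U. openin T U \<Longrightarrow> gzero \<in> U \<Longrightarrow> \<exists>m. V m \<inter> H \<subseteq> U"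
    and V: "\<And>n. openin T (V n)" "\<And>n. gzero \<in> V n"
      "\<And>n x y. x \<in> V (Suc n) \<Longrightarrow> y \<in> V (Suc n) \<Longrightarrow> add x y \<in> V n" "decseq V"
    and b: "\<And>n. b n \<in> V n"
    and lim: "limitin (coset_space T add H) (\<lambda>n. left_coset add H (b n))
      (left_coset add H gzero) sequentially"
  shows "limitin T b gzero sequentially"
  unfolding limitin_sequentially
proof (intro conjI allI impI)
  note H' = strong_subgyrogroupD[OF H]
  show "gzero \<in> topspace T"
    by (simp add: topspace_eq zero_closed)
  fix U assume "openin T U \<and> gzero \<in> U"
  then obtain U' where U': "openin T U'" "gzero \<in> U'"
    "\<And>x y. x \<in> U' \<Longrightarrow> y \<in> U' \<Longrightarrow> add x y \<in> U"
    using nhd_zero_add by metis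
  obtain m where m: "V m \<inter> H \<subseteq> U'"
    using base U' by blast
  \<comment> \<open>The representative \<open>p\<close> taken from \<open>P\<close> has two duties:
    to be a small summand itself, and to have a small inverse so that \<open>h\<close> can be
    bounded.\<close>
  define P where "P = U' \<inter> {x \<in> topspace T. gneg x \<in> V (Suc m)}"
  have "openin T P" "gzero \<in> P"
    using openin_continuous_map_preimage[OF continuous_minus V(1)] U' V(2) zero_closed
    by (auto simp: P_def topspace_eq minus_zero)
  then have "openin (coset_space T add H) (left_coset add H ` P)"
    using open_map_left_coset[OF H] by (simp add: open_map_def)
  then obtain N where N: "\<And>n. n \<ge> N \<Longrightarrow> left_coset add H (b n) \<in> left_coset add H ` P"
    using lim \<open>gzero \<in> P\<close> unfolding limitin_sequentially by (meson image_eqI)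
  show "\<exists>N. \<forall>n\<ge>N. b n \<in> U"
  proof (intro exI allI impI)
    \<comment> \<open>\<open>N\<close> brings the coset of \<open>b n\<close> into the image of
      \<open>P\<close>; \<open>Suc m\<close> brings \<open>b n\<close> into
      \<open>V (Suc m)\<close>, one level below the target \<open>V m\<close> for
      \<open>h\<close>.\<close>
    fix n assume n: "max N (Suc m) \<le> n"
    have bG: "b n \<in> G"
      using b V(1) openin_subset topspace_eq by blast
    obtain p where p: "p \<in> P" "left_coset add H (b n) = left_coset add H p"
      using N[of n] n by auto
    have pG: "p \<in> G"
      using p(1) by (simp add: P_def topspace_eq)
    have "b n \<in> left_coset add H (b n)"
      unfolding left_coset_def using H'(4) bG add_zero_right by force
    then obtain h where h: "h \<in> H" "b n = add p h"
      using p(2) by (auto simp: left_coset_def)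
    have "h = add (gneg p) (b n)"
      using h H'(1) pG by (auto simp: minus_add_cancel)
    moreover have "b n \<in> V (Suc m)"
      using b[of n] \<open>decseq V\<close> n by (auto simp: decseq_def)
    moreover have "gneg p \<in> V (Suc m)"
      using p(1) by (simp add: P_def)
    ultimately have "h \<in> V m"
      using V(3) by simp
    then have "h \<in> U'"
      using m h(1) by blast
    then show "b n \<in> U"
      using U'(3) p(1) h(2) by (simp add: P_def)
  qed
qed

text \<open>Members of a countable local base in \<open>H\<close> are traces of sets open in
  \<open>T\<close>; those containing zero are enumerated, possibly with repetitions.\<close>

lemma first_countable_trace_base:
  assumes "first_countable (subtopology T H)" "gzero \<in> H"
  shows "\<exists>W :: nat \<Rightarrow> 'a set. (\<forall>n. openin T (W n) \<and> gzero \<in> W n) \<and>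
    (\<forall>U. openin T U \<and> gzero \<in> U \<longrightarrow> (\<exists>m. W m \<inter> H \<subseteq> U))"
proof -
  have "gzero \<in> topspace (subtopology T H)"
    by (simp add: assms(2) topspace_eq zero_closed)
  with assms(1) obtain \<B> where \<B>: "countable \<B>" "\<And>B. B \<in> \<B> \<Longrightarrow> openin (subtopology T H) B"
    "\<And>U. openin (subtopology T H) U \<Longrightarrow> gzero \<in> U \<Longrightarrow> \<exists>B\<in>\<B>. gzero \<in> B \<and> B \<subseteq> U"
    unfolding first_countable_def by meson
  define \<C> where "\<C> = {B \<in> \<B>. gzero \<in> B}"
  have "countable \<C>"
    using \<B>(1) by (simp add: \<C>_def)
  \<comment> \<open>Nonemptiness ensures that every value of \<open>from_nat_into\<close> is a
    member of \<open>\<C>\<close>.\<close>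
  have "\<C> \<noteq> {}"
    using \<B>(3)[OF openin_topspace] \<open>gzero \<in> topspace (subtopology T H)\<close> by (auto simp: \<C>_def)
  have "\<exists>W. openin T W \<and> gzero \<in> W \<and> from_nat_into \<C> n = W \<inter> H" for n
    using from_nat_into[OF \<open>\<C> \<noteq> {}\<close>, of n] \<B>(2)
    by (force simp: \<C>_def openin_subtopology)
  then obtain W where W: "\<And>n. openin T (W n) \<and> gzero \<in> W n \<and> from_nat_into \<C> n = W n \<inter> H"
    by metis
  show ?thesis
  proof (intro exI[of _ W] conjI allI impI)
    show "openin T (W n)" "gzero \<in> W n" for n
      using W by blast+
    fix U assume U: "openin T U \<and> gzero \<in> U"
    then have "openin (subtopology T H) (U \<inter> H)"
      by (auto simp: openin_subtopology)
    then obtain B where B: "B \<in> \<C>" "B \<subseteq> U \<inter> H"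
      using \<B>(3) U assms(2) by (force simp: \<C>_def)
    then obtain m where "from_nat_into \<C> m = B"
      using from_nat_into_surj[OF \<open>countable \<C>\<close>] by blast
    with W B(2) have "W m \<inter> H \<subseteq> U" by auto
    then show "\<exists>m. W m \<inter> H \<subseteq> U" ..
  qed
qed

lemma strictly_frechet_urysohn_at_zero:
  assumes H: "strong_subgyrogroup G add gyr H"
    and fc: "first_countable (subtopology T H)"
    and sfu: "strictly_frechet_urysohn (coset_space T add H)"
    and A: "\<And>n::nat. gzero \<in> T closure_of A n"
  shows "\<exists>s. (\<forall>n. s n \<in> A n) \<and> limitin T s gzero sequentially"
proof -
  let ?p = "left_coset add H" and ?Q = "coset_space T add H"
  have cont: "continuous_map T ?Q ?p"
    unfolding coset_space_def by (intro quotient_imp_continuous_map quotient_map_quotient_topology)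
  obtain W :: "nat \<Rightarrow> 'a set" where W: "\<forall>n. openin T (W n) \<and> gzero \<in> W n"
    and base: "\<forall>U. openin T U \<and> gzero \<in> U \<longrightarrow> (\<exists>m. W m \<inter> H \<subseteq> U)"
    using first_countable_trace_base[OF fc strong_subgyrogroupD(4)[OF H]] by (elim exE conjE)
  obtain V where *: "\<forall>n. openin T (V n) \<and> gzero \<in> V n \<and> V n \<subseteq> W n"
    "\<forall>n. \<forall>x\<in>V (Suc n). \<forall>y\<in>V (Suc n). add x y \<in> V n" and "decseq V"
    using nhd_zero_sequence[of W, OF W[rule_format]] by (elim exE conjE)
  from * have V: "openin T (V n)" "gzero \<in> V n" "V n \<subseteq> W n"
    "x \<in> V (Suc n) \<Longrightarrow> y \<in> V (Suc n) \<Longrightarrow> add x y \<in> V n" for n x y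
    by simp_all
  \<comment> \<open>Cutting by the open neighbourhood \<open>V n\<close> keeps zero in the closure
    and forces the points chosen later into \<open>V n\<close>.\<close>
  define B where "B = (\<lambda>n. A n \<inter> V n)"
  have "gzero \<in> T closure_of B n" for n
    unfolding in_closure_of
  proof (intro conjI allI impI)
    show "gzero \<in> topspace T"
      by (simp add: topspace_eq zero_closed)
    fix U assume "gzero \<in> U \<and> openin T U"
    then have "gzero \<in> U \<inter> V n" "openin T (U \<inter> V n)"
      using V(1,2) by auto
    then show "\<exists>y. y \<in> B n \<and> y \<in> U"
      using A[of n] unfolding in_closure_of B_def by blast
  qed
  then have "?p gzero \<in> ?Q closure_of ?p ` B n" for n
    using continuous_map_image_closure_subset[OF cont] by blast
  moreover have "?p ` B n \<subseteq> topspace ?Q" for n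
    using openin_subset[OF V(1)[of n]] by (auto simp: B_def coset_space_def)
  moreover have "?p gzero \<in> topspace ?Q"
    by (simp add: coset_space_def topspace_eq zero_closed)
  ultimately have "\<exists>s. (\<forall>n. s n \<in> ?p ` B n) \<and> limitin ?Q s (?p gzero) sequentially"
    using sfu[unfolded strictly_frechet_urysohn_def, rule_format, of "?p gzero" "\<lambda>n. ?p ` B n"]
    by blast
  then obtain s where s: "\<And>n. s n \<in> ?p ` B n" "limitin ?Q s (?p gzero) sequentially"
    by blast
  \<comment> \<open>The sequence \<open>s\<close> consists of cosets; representatives are chosen
    inside \<open>B n\<close>.\<close>
  have "\<forall>n. \<exists>x. x \<in> B n \<and> s n = ?p x"
    using s(1) by blast
  then obtain b where b: "\<forall>n. b n \<in> B n \<and> s n = ?p (b n)"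
    by (rule choice[THEN exE])
  have "limitin T b gzero sequentially"
  proof (rule limitin_zero_of_coset_limit[OF H _ V(1,2,4) \<open>decseq V\<close>])
    \<comment> \<open>The trace property passes from \<open>W\<close> to the smaller sets
      \<open>V\<close>.\<close>
    show "\<exists>m. V m \<inter> H \<subseteq> U" if "openin T U" "gzero \<in> U" for U
      using base that V(3) by (meson Int_mono order_refl subset_trans)
    show "b n \<in> V n" for n
      using b by (auto simp: B_def)
    show "limitin ?Q (\<lambda>n. ?p (b n)) (?p gzero) sequentially"
      using s(2) b by (simp add: limitin_def)
  qed
  then show ?thesis
    using b by (auto simp: B_def)
qed

text \<open>Translation by \<open>gneg x\<close> moves the problem to zero, and translation by
  \<open>x\<close> undoes it by \<open>add_minus_cancel\<close>; both are continuous.\<close>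

lemma strictly_frechet_urysohn_of_coset_space:
  assumes H: "strong_subgyrogroup G add gyr H"
    and fc: "first_countable (subtopology T H)"
    and sfu: "strictly_frechet_urysohn (coset_space T add H)"
  shows "strictly_frechet_urysohn T"
  unfolding strictly_frechet_urysohn_def
proof (intro ballI allI impI)
  fix x and A :: "nat \<Rightarrow> 'a set"
  assume "x \<in> topspace T" and A: "(\<forall>n. A n \<subseteq> topspace T) \<and> x \<in> (\<Inter>n. T closure_of A n)"
  then have x: "x \<in> G"
    by (simp add: topspace_eq)
  have "gzero \<in> T closure_of add (gneg x) ` A n" for n
    using continuous_map_image_closure_subset[OF continuous_map_add_left[OF minus_closed[OF x]]] A
      minus_left[OF x] by (metis INT_iff UNIV_I image_eqI subset_iff)
  then obtain s where s: "\<And>n. s n \<in> add (gneg x) ` A n" "limitin T s gzero sequentially"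
    using strictly_frechet_urysohn_at_zero[OF H fc sfu, of "\<lambda>n. add (gneg x) ` A n"] by blast
  have "add x (s n) \<in> A n" for n
  proof -
    obtain a where a: "a \<in> A n" "s n = add (gneg x) a"
      using s(1) by blast
    then have "a \<in> G"
      using A topspace_eq by blast
    then show ?thesis
      using a x by (simp add: add_minus_cancel)
  qed
  moreover have "limitin T (add x \<circ> s) x sequentially"
    using continuous_map_limit[OF continuous_map_add_left[OF x] s(2)] x by (simp add: add_zero_right)
  ultimately show "\<exists>s. (\<forall>n. s n \<in> A n) \<and> limitin T s x sequentially"
    by (intro exI[of _ "add x \<circ> s"]) simp
qed

end

theorem theorem5p3:
  fixes G :: "'a set" and add :: "'a \<Rightarrow> 'a \<Rightarrow> 'a" and gyr :: "'a \<Rightarrow> 'a \<Rightarrow> 'a \<Rightarrow> 'a"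
    and T :: "'a topology" and H :: "'a set"
  assumes "strongly_topological_gyrogroup G add gyr T"
    and "strong_subgyrogroup G add gyr H"
    and "locally_compact_space (subtopology T H)"
    and "metrizable_space (subtopology T H)"
    and "strictly_frechet_urysohn (coset_space T add H)"
  shows "strictly_frechet_urysohn T"
proof -
  interpret strongly_topological_gyrogroup G add gyr T
    by (rule assms(1))
  show ?thesis
    \<comment> \<open>Metrizability of \<open>H\<close> enters through first countability.\<close>
    using assms(2,4,5)
    by (intro strictly_frechet_urysohn_of_coset_space metrizable_imp_first_countable)
qed

end
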